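(* Let $A\in\mathbb{R}^{n\times n}$, $B\in\mathbb{R}^{n\times m}$, $K\in\mathbb{R}^{m\times n}$ be such that $(A,B)$ is stabilizable and $A_{cl}=A-BK$ is Hurwitz, let $Q\in\mathbb{R}^{n\times n}$ be symmetric positive definite, let $P$ be the unique symmetric positive definite solution of $A_{cl}^\top P+PA_{cl}=-Q$, and let $\sigma\in(0,1)$. Let $$\mathcal{T}_{\mathrm{dir}}=\{(x,e):\ 2x^\top PBKe\le\sigma x^\top Px\}.$$ Then the set $\mathcal{T}_{\mathrm{dir}}$ defines a half-space in error coordinates (that is, in $e\in\mathbb{R}^n$, for fixed state $x\in\mathbb{R}^n$), bounded by the hyperplane orthogonal to $v=(PBK)^\top x$.
   Context: Here $x\in\mathbb{R}^n$ is the state and $e\in\mathbb{R}^n$ the sampling-induced error of an event-triggered control system $\dot x=A_{cl}x+BKe$; $\mathcal{T}_{\mathrm{dir}}$ is called the directional triggering set. The bounding hyperplane is the one on which the defining inequality holds with equality, i.e. $v^\top e=\sigma x^\top Px/2$.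
   Formalization: The half-space and bounding-hyperplane claims are proved for states x with v = (PBK)^T x nonzero; when v = 0 (for example x = 0) every e satisfies the inequality, so the set is all of R^n with no bounding hyperplane, and this is what is proved in that case. *)

theory Defs
  imports "HOL-Analysis.Analysis"
begin

definition complex_matrix :: "real ^ 'n ^ 'm \<Rightarrow> complex ^ 'n ^ 'm" where
  "complex_matrix A = (\<chi> i j. complex_of_real (A $ i $ j))"

definition complex_eigenvalue :: "real ^ 'n ^ 'n \<Rightarrow> complex \<Rightarrow> bool" where
  "complex_eigenvalue A \<mu> \<longleftrightarrow> (\<exists>w. w \<noteq> 0 \<and> complex_matrix A *v w = \<mu> *s w)"

definition hurwitz :: "real ^ 'n ^ 'n \<Rightarrow> bool" where
  "hurwitz A \<longleftrightarrow> (\<forall>\<mu>. complex_eigenvalue A \<mu> \<longrightarrow> Re \<mu> < 0)"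

definition stabilizable :: "real ^ 'n ^ 'n \<Rightarrow> real ^ 'm ^ 'n \<Rightarrow> bool" where
  "stabilizable A B \<longleftrightarrow> (\<exists>F :: real ^ 'n ^ 'm. hurwitz (A - B ** F))"

definition symmetric_pos_def :: "real ^ 'n ^ 'n \<Rightarrow> bool" where
  "symmetric_pos_def M \<longleftrightarrow> transpose M = M \<and> (\<forall>x. x \<noteq> 0 \<longrightarrow> 0 < x \<bullet> (M *v x))"

definition T_dir ::
  "real ^ 'm ^ 'n \<Rightarrow> real ^ 'n ^ 'm \<Rightarrow> real ^ 'n ^ 'n \<Rightarrow> real \<Rightarrow> ((real ^ 'n) \<times> (real ^ 'n)) set"
  where
  "T_dir B K P \<sigma> =
     {(x, e). 2 * (x \<bullet> ((P ** B ** K) *v e)) \<le> \<sigma> * (x \<bullet> (P *v x))}"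

definition T_dir_equality ::
  "real ^ 'm ^ 'n \<Rightarrow> real ^ 'n ^ 'm \<Rightarrow> real ^ 'n ^ 'n \<Rightarrow> real \<Rightarrow> ((real ^ 'n) \<times> (real ^ 'n)) set"
  where
  "T_dir_equality B K P \<sigma> =
     {(x, e). 2 * (x \<bullet> ((P ** B ** K) *v e)) = \<sigma> * (x \<bullet> (P *v x))}"

(* Both notions require a nonzero normal: neither the empty set nor the whole space
   counts as a half-space or as a hyperplane. *)
definition closed_half_space :: "'a :: euclidean_space set \<Rightarrow> bool" where
  "closed_half_space S \<longleftrightarrow> (\<exists>a b. a \<noteq> 0 \<and> S = {y. a \<bullet> y \<le> b})"

definition hyperplane :: "'a :: euclidean_space set \<Rightarrow> bool" where
  "hyperplane H \<longleftrightarrow> (\<exists>a b. a \<noteq> 0 \<and> H = {y. a \<bullet> y = b})"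

(* H need not pass through the origin, so orthogonality is to its direction space. *)
definition orthogonal_to_hyperplane :: "'a :: euclidean_space \<Rightarrow> 'a set \<Rightarrow> bool" where
  "orthogonal_to_hyperplane v H \<longleftrightarrow> (\<forall>y\<in>H. \<forall>z\<in>H. orthogonal v (y - z))"

end

theory Submission
  imports Defs
begin

text \<open>For fixed \<open>x\<close>, moving \<open>P ** B ** K\<close> to the other side of the
  inner product turns the triggering condition into \<open>v \<bullet> e \<le> c\<close>, with
  \<open>c\<close> half of \<open>\<sigma> * (x \<bullet> (P *v x))\<close>. For nonzero
  \<open>v\<close> this is a half-space with normal \<open>v\<close>, and
  \<open>frontier_halfspace_le\<close> identifies its boundary with the equality set. For
  \<open>v = 0\<close> it degenerates to \<open>0 \<le> c\<close>, which every \<open>e\<close>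
  satisfies because \<open>P\<close> is positive definite and \<open>\<sigma>\<close>
  positive.\<close>

theorem proposition1:
  fixes A Q P A\<^sub>c\<^sub>l :: "real ^ 'n ^ 'n"
    and B :: "real ^ 'm ^ 'n"
    and K :: "real ^ 'n ^ 'm"
    and \<sigma> :: real
    and x v :: "real ^ 'n"
  assumes "stabilizable A B"
    and "A\<^sub>c\<^sub>l = A - B ** K"
    and "hurwitz A\<^sub>c\<^sub>l"
    and "symmetric_pos_def Q"
    and "symmetric_pos_def P"
    and "transpose A\<^sub>c\<^sub>l ** P + P ** A\<^sub>c\<^sub>l = - Q"
    and "0 < \<sigma>" and "\<sigma> < 1"
    and "v = transpose (P ** B ** K) *v x"
  shows "T_dir B K P \<sigma> `` {x} = {e. v \<bullet> e \<le> \<sigma> * (x \<bullet> (P *v x)) / 2}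
    \<and> T_dir_equality B K P \<sigma> `` {x} = {e. v \<bullet> e = \<sigma> * (x \<bullet> (P *v x)) / 2}
    \<and> (v \<noteq> 0 \<longrightarrow>
         closed_half_space (T_dir B K P \<sigma> `` {x})
       \<and> hyperplane (T_dir_equality B K P \<sigma> `` {x})
       \<and> frontier (T_dir B K P \<sigma> `` {x}) = T_dir_equality B K P \<sigma> `` {x}
       \<and> orthogonal_to_hyperplane v (T_dir_equality B K P \<sigma> `` {x}))
    \<and> (v = 0 \<longrightarrow> T_dir B K P \<sigma> `` {x} = UNIV)"
proof -
  define c where "c = \<sigma> * (x \<bullet> (P *v x)) / 2"
  have adjoint: "v \<bullet> e = x \<bullet> ((P ** B ** K) *v e)" for e
    \<comment> \<open>The transpose is rewritten as the row product
      \<open>x v* (P ** B ** K)\<close>, which \<open>dot_lmul_matrix\<close> carries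
      across.\<close>
    using assms(9) by (simp add: transpose_matrix_vector dot_lmul_matrix)
  have le: "T_dir B K P \<sigma> `` {x} = {e. v \<bullet> e \<le> c}"
    by (auto simp: T_dir_def c_def adjoint)
  have eq: "T_dir_equality B K P \<sigma> `` {x} = {e. v \<bullet> e = c}"
    by (auto simp: T_dir_equality_def c_def adjoint)
  \<comment> \<open>This serves the degenerate case \<open>v = 0\<close>. The split is there because
    \<open>symmetric_pos_def\<close> speaks of nonzero vectors only.\<close>
  have "x \<bullet> (P *v x) \<ge> 0"
    using assms(5) by (cases "x = 0") (auto simp: symmetric_pos_def_def less_imp_le)
  then have "c \<ge> 0"
    using assms(7) by (simp add: c_def)
  then have "v = 0 \<longrightarrow> {e. v \<bullet> e \<le> c} = UNIV"
    by simp
  moreover have "v \<noteq> 0 \<longrightarrow> closed_half_space {e. v \<bullet> e \<le> c} \<and> hyperplane {e. v \<bullet> e = c}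
      \<and> frontier {e. v \<bullet> e \<le> c} = {e. v \<bullet> e = c}"
    unfolding closed_half_space_def hyperplane_def using frontier_halfspace_le by blast
  \<comment> \<open>Two points of the hyperplane have the same product \<open>c\<close> with
    \<open>v\<close>, so \<open>v\<close> annihilates their difference.\<close>
  moreover have "orthogonal_to_hyperplane v {e. v \<bullet> e = c}"
    by (simp add: orthogonal_to_hyperplane_def orthogonal_def inner_diff_right)
  ultimately show ?thesis
    unfolding le eq c_def by blast
qed

end
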